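(* Let $\mathcal{X}^*\subset\mathbb{R}^n$ denote the set of minimizers of $$\min_{\boldsymbol{x}\in\mathbb{R}^n}\ \tfrac12\|\boldsymbol{A}\boldsymbol{x}-\boldsymbol{b}\|_{\boldsymbol{W}}^2+\lambda\|\boldsymbol{D}\boldsymbol{x}\|_1 ,$$ and let $\{\boldsymbol{x}^{(k)}\}_{k=1}^\infty$ be the iterates generated by the Primal-Dual Frank-Wolfe (PDFW) algorithm (defined in the context) with $\theta=0$. Suppose the iterates $\{\boldsymbol{x}^{(k)}\}_{k=1}^\infty$ are bounded. If the step-size sequences $\{\alpha_k\}_{k\ge 0}\subset[0,1]$, $\{\sigma_k\}_{k\ge 0}\subset(0,\infty)$ and $\{\tau_k\}_{k\ge 0}\subset(0,\infty)$ satisfy $\tau_k\to 0$, $\sum_{k=0}^\infty\tau_k=+\infty$, and $$\sum_{j=1}^k\tau_{j-1}\prod_{i=j}^k(1-\alpha_i)\to 0,\qquad \sum_{j=1}^k\tau_{j-1}\prod_{i=j}^k\frac{1}{1+\sigma_i}\to 0$$ as $k\to\infty$, then $\mathrm{dist}(\boldsymbol{x}^{(k)},\mathcal{X}^* )\to 0$ as $k\to\infty$, where $\mathrm{dist}$ denotes the Euclidean distance of a point to a set. In particular, if the minimization problem has a unique solution $\boldsymbol{x}^*$, then $\boldsymbol{x}^{(k)}\to\boldsymbol{x}^*$.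
   Context: Setting. $\boldsymbol{A}\in\mathbb{R}^{m\times n}$ with $m\le n$; $\boldsymbol{b}\in\mathbb{R}^m$; $\boldsymbol{W}\in\mathbb{R}^{m\times m}$ is a fixed diagonal matrix with positive diagonal entries, and $\|\boldsymbol{z}\|_{\boldsymbol{W}}=\sqrt{\boldsymbol{z}^T\boldsymbol{W}\boldsymbol{z}}$; $\lambda>0$. The matrix $\boldsymbol{D}\in\mathbb{R}^{N\times n}$ is tall ($N>n$) and has block form $\boldsymbol{D}=[\boldsymbol{D}_1^T\ \boldsymbol{D}_2^T\ \cdots\ \boldsymbol{D}_\ell^T]^T$ with $\boldsymbol{D}_i\in\mathbb{R}^{N_i\times n}$ and $N=\sum_{i=1}^\ell N_i$. $\|\cdot\|_1$ is the $\ell^1$-norm. The function $\mathrm{sign}(\cdot)$ is applied entrywise, with $\mathrm{sign}(0)=0$. Primal-Dual Frank-Wolfe (PDFW) algorithm. Choose step-sizes $\tau_k>0$, $\sigma_k>0$, $\alpha_k\in[0,1]$ for $k\ge 0$ and a parameter $\theta\in[0,1]$. Initialize $\boldsymbol{x}^{(0)}=\overline{\boldsymbol{x}}^{(0)}\in\mathbb{R}^n$, $\boldsymbol{z}^{(0)}=0\in\mathbb{R}^n$, $\boldsymbol{t}^{(0)}=0\in\mathbb{R}^m$. For $k=0,1,2,\dots$ set $$\boldsymbol{t}^{(k+1)}=\tfrac{1}{1+\sigma_k}\boldsymbol{t}^{(k)}+\tfrac{\sigma_k}{1+\sigma_k}\boldsymbol{W}(\boldsymbol{A}\overline{\boldsymbol{x}}^{(k)}-\boldsymbol{b}),$$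 $$\boldsymbol{z}^{(k+1)}=(1-\alpha_k)\boldsymbol{z}^{(k)}+\alpha_k\lambda\sum_{i=1}^{\ell}\boldsymbol{D}_i^T\,\mathrm{sign}(\boldsymbol{D}_i\overline{\boldsymbol{x}}^{(k)}),$$ $$\boldsymbol{x}^{(k+1)}=\boldsymbol{x}^{(k)}-\tau_k(\boldsymbol{A}^T\boldsymbol{t}^{(k+1)}+\boldsymbol{z}^{(k+1)}),$$ $$\overline{\boldsymbol{x}}^{(k+1)}=\boldsymbol{x}^{(k+1)}+\theta(\boldsymbol{x}^{(k+1)}-\boldsymbol{x}^{(k)}).$$ When $\theta=0$, $\overline{\boldsymbol{x}}^{(k)}=\boldsymbol{x}^{(k)}$ for all $k$. *)

theory Defs
  imports "HOL-Analysis.Analysis"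
begin

(* A matrix with n columns and a number of rows that is not fixed by a type: the list of
   its rows.  This allows a block matrix whose blocks have different heights; stacking the
   blocks D_1, ..., D_l on top of each other is concat [D_1, ..., D_l]. *)
type_synonym 'n rows = "(real ^ 'n) list"

definition rows_mult_vec :: "'n::finite rows \<Rightarrow> real ^ 'n \<Rightarrow> real list" where
  "rows_mult_vec R x = map (\<lambda>r. r \<bullet> x) R"

(* The product R^T y, as the combination of the rows of R with coefficients y;
   meant for length y = length R. *)
definition transpose_rows_mult_vec :: "'n::finite rows \<Rightarrow> real list \<Rightarrow> real ^ 'n" where
  "transpose_rows_mult_vec R y = (\<Sum>j<length R. (y ! j) *\<^sub>R (R ! j))"

definition l1_norm :: "real list \<Rightarrow> real" where
  "l1_norm y = (\<Sum>v\<leftarrow>y. \<bar>v\<bar>)"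

definition weighted_norm :: "real ^ 'm ^ 'm \<Rightarrow> real ^ 'm \<Rightarrow> real" where
  "weighted_norm W z = sqrt (z \<bullet> (W *v z))"

definition objective ::
  "real ^ 'n ^ 'm \<Rightarrow> real ^ 'm \<Rightarrow> real ^ 'm ^ 'm \<Rightarrow> real \<Rightarrow> 'n rows \<Rightarrow> real ^ 'n \<Rightarrow> real"
where
  "objective A b W lam D x =
     1 / 2 * (weighted_norm W (A *v x - b))\<^sup>2 + lam * l1_norm (rows_mult_vec D x)"

definition minimizers ::
  "real ^ 'n ^ 'm \<Rightarrow> real ^ 'm \<Rightarrow> real ^ 'm ^ 'm \<Rightarrow> real \<Rightarrow> 'n rows \<Rightarrow> (real ^ 'n) set"
where
  "minimizers A b W lam D = {x. is_arg_min (objective A b W lam D) (\<lambda>_. True) x}"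

(* The sequences x, xbar, z, t are the ones generated by the primal-dual Frank-Wolfe
   iteration with blocks Ds from the (arbitrary) starting point x 0. *)
definition pdfw_iterates ::
  "real ^ 'n ^ 'm \<Rightarrow> real ^ 'm \<Rightarrow> real ^ 'm ^ 'm \<Rightarrow> real \<Rightarrow> 'n rows list \<Rightarrow>
   (nat \<Rightarrow> real) \<Rightarrow> (nat \<Rightarrow> real) \<Rightarrow> (nat \<Rightarrow> real) \<Rightarrow> real \<Rightarrow>
   (nat \<Rightarrow> real ^ 'n) \<Rightarrow> (nat \<Rightarrow> real ^ 'n) \<Rightarrow> (nat \<Rightarrow> real ^ 'n) \<Rightarrow> (nat \<Rightarrow> real ^ 'm) \<Rightarrow> bool"
where
  "pdfw_iterates A b W lam Ds \<tau> \<sigma> \<alpha> \<theta> x xbar z t \<longleftrightarrow>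
     xbar 0 = x 0 \<and> z 0 = 0 \<and> t 0 = 0 \<and>
     (\<forall>k.
        t (Suc k) = (1 / (1 + \<sigma> k)) *\<^sub>R t k
                    + (\<sigma> k / (1 + \<sigma> k)) *\<^sub>R (W *v (A *v xbar k - b)) \<and>
        z (Suc k) = (1 - \<alpha> k) *\<^sub>R z k
                    + (\<alpha> k * lam) *\<^sub>R
                      (\<Sum>Di\<leftarrow>Ds. transpose_rows_mult_vec Di (map sgn (rows_mult_vec Di (xbar k)))) \<and>
        x (Suc k) = x k - \<tau> k *\<^sub>R (transpose A *v t (Suc k) + z (Suc k)) \<and>
        xbar (Suc k) = x (Suc k) + \<theta> *\<^sub>R (x (Suc k) - x k))"

end

theory Submission
  imports Defs
begin

text \<open>
  The objective is \<open>f = q + h\<close> with \<open>q\<close> the weighted least-squares term and \<open>h\<close> the \<open>\<ell>\<^sup>1\<close> term,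
  and the iteration with \<open>\<theta> = 0\<close> is subgradient descent in disguise: the direction
  \<open>transpose A *v t (Suc k) + z (Suc k)\<close> is the sum of two running averages, one of the gradients of
  \<open>q\<close> at \<open>x 0, \<dots>, x k\<close>, where the newest one gets weight \<open>\<sigma> k / (1 + \<sigma> k)\<close>, and one of subgradients
  of \<open>h\<close> at these points, where the newest one gets weight \<open>\<alpha> k\<close>. Both averages start from 0.

  The two hypotheses on sums of products say that these averages have a short memory when time is
  measured by the distance travelled. In the average formed at step \<open>k\<close>, the product over
  \<open>i = j, \<dots>, k\<close> is the total weight of what was recorded before step \<open>j\<close>, and \<open>\<tau> (j - 1)\<close> bounds, up
  to a constant, the move from \<open>x (j - 1)\<close> to \<open>x j\<close>. By summation by parts, the sum of the products
  therefore bounds, up to a constant, the average distance from \<open>x k\<close> to the points whose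
  subgradients are being averaged. It tends to 0, so each average is an \<open>\<epsilon>\<close>-subgradient at
  \<open>x k\<close> of its part of the objective, with \<open>\<epsilon>\<close> tending to 0
  (\<open>averaged_subgradients_approximate\<close>).

  The rest is the classical argument for subgradient descent with vanishing steps of divergent sum
  (\<open>approximate_subgradient_descent\<close>): the squared distance to any point \<open>y\<close> drops by about
  \<open>2 * \<tau> k * (f (x k) - f y)\<close> per step, so the values \<open>f (x k)\<close> cannot stay away from the infimum.
  Since the iterates are bounded, this produces a minimizer, and then the same estimate applied to
  the minimizer nearest to \<open>x k\<close> gives convergence of the distance.
\<close>

section \<open>Averages of past subgradients\<close>

text \<open>
  The gap on the left measures by how much the average fails to be a subgradient at \<open>x k\<close>. Mixing in
  an exact subgradient, whose gap is at most 0, scales the gap by at most \<open>1 - \<alpha> k\<close>, while moving the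
  base point from \<open>x (k - 1)\<close> to \<open>x k\<close> raises it by at most a multiple of \<open>\<tau> (k - 1)\<close>; the right-hand side solves this recursion.
\<close>

lemma averaged_subgradient_gap:
  fixes h :: "'a::real_inner \<Rightarrow> real" and x s z :: "nat \<Rightarrow> 'a" and \<alpha> \<tau> :: "nat \<Rightarrow> real"
  assumes subgradient: "\<And>k y. h (x k) + s k \<bullet> (y - x k) \<le> h y"
    and average: "\<And>k. z (Suc k) = (1 - \<alpha> k) *\<^sub>R z k + \<alpha> k *\<^sub>R s k"
    and weights: "\<And>k. 0 \<le> \<alpha> k \<and> \<alpha> k \<le> 1"
    and bounds: "\<And>k. norm (s k) \<le> S" "\<And>k. norm (z k) \<le> S"
    and steps: "\<And>k. norm (x (Suc k) - x k) \<le> M * \<tau> k"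
  shows "z (Suc k) \<bullet> (y - x k) - (h y - h (x k))
    \<le> 2 * S * M * (\<Sum>j=1..k. \<tau> (j - 1) * (\<Prod>i=j..k. 1 - \<alpha> i))
      + (\<Prod>i=1..k. 1 - \<alpha> i) * (z 1 \<bullet> (y - x 0) - (h y - h (x 0)))"
proof (induction k)
  case 0
  then show ?case by simp
next
  case (Suc k)
  define E where "E = (\<lambda>k. z (Suc k) \<bullet> (y - x k) - (h y - h (x k)))"
  have S0: "S \<ge> 0"
    using bounds(1)[of 0] norm_ge_zero[of "s 0"] by linarith
  have drift: "z (Suc k) \<bullet> (x k - x (Suc k)) + (h (x (Suc k)) - h (x k)) \<le> 2 * S * M * \<tau> k"
  proof -
    have "z (Suc k) \<bullet> (x k - x (Suc k)) \<le> norm (z (Suc k)) * norm (x (Suc k) - x k)"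
      by (metis norm_cauchy_schwarz norm_minus_commute)
    also have "\<dots> \<le> S * (M * \<tau> k)"
      by (intro mult_mono bounds steps S0) simp
    finally have 1: "z (Suc k) \<bullet> (x k - x (Suc k)) \<le> S * (M * \<tau> k)" .
    \<comment> \<open>The subgradient at the new point replaces a Lipschitz constant for \<open>h\<close>.\<close>
    have "h (x (Suc k)) - h (x k) \<le> s (Suc k) \<bullet> (x (Suc k) - x k)"
      using subgradient[of "Suc k" "x k"] by (simp add: inner_diff_right)
    also have "\<dots> \<le> norm (s (Suc k)) * norm (x (Suc k) - x k)"
      by (rule norm_cauchy_schwarz)
    also have "\<dots> \<le> S * (M * \<tau> k)"
      by (intro mult_mono bounds steps S0) simp
    finally show ?thesis using 1 by simp
  qed
  have "E (Suc k) = (1 - \<alpha> (Suc k)) *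
        (E k + (z (Suc k) \<bullet> (x k - x (Suc k)) + (h (x (Suc k)) - h (x k))))
      + \<alpha> (Suc k) * (s (Suc k) \<bullet> (y - x (Suc k)) - (h y - h (x (Suc k))))"
    unfolding E_def average[of "Suc k"]
    by (simp add: inner_add_left inner_diff_right algebra_simps)
  also have "\<dots> \<le> (1 - \<alpha> (Suc k)) * (E k + 2 * S * M * \<tau> k) + \<alpha> (Suc k) * 0"
    using drift weights[of "Suc k"] subgradient[of "Suc k" y]
    by (intro add_mono mult_left_mono) auto
  also have "\<dots> \<le> (1 - \<alpha> (Suc k)) *
      (2 * S * M * (\<Sum>j=1..k. \<tau> (j - 1) * (\<Prod>i=j..k. 1 - \<alpha> i))
        + (\<Prod>i=1..k. 1 - \<alpha> i) * E 0 + 2 * S * M * \<tau> k)"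
    using Suc.IH weights[of "Suc k"] by (simp add: E_def mult_left_mono)
  also have "\<dots> = 2 * S * M * (\<Sum>j=1..Suc k. \<tau> (j - 1) * (\<Prod>i=j..Suc k. 1 - \<alpha> i))
      + (\<Prod>i=1..Suc k. 1 - \<alpha> i) * E 0"
  proof -
    have "(\<Sum>j=1..Suc k. \<tau> (j - 1) * (\<Prod>i=j..Suc k. 1 - \<alpha> i))
        = (\<Sum>j=1..k. \<tau> (j - 1) * ((\<Prod>i=j..k. 1 - \<alpha> i) * (1 - \<alpha> (Suc k))))
          + \<tau> k * (1 - \<alpha> (Suc k))"
      by simp
    also have "\<dots> = (1 - \<alpha> (Suc k)) * ((\<Sum>j=1..k. \<tau> (j - 1) * (\<Prod>i=j..k. 1 - \<alpha> i)) + \<tau> k)"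
      by (simp add: sum_distrib_left algebra_simps)
    finally have *: "(\<Sum>j=1..Suc k. \<tau> (j - 1) * (\<Prod>i=j..Suc k. 1 - \<alpha> i))
        = (1 - \<alpha> (Suc k)) * ((\<Sum>j=1..k. \<tau> (j - 1) * (\<Prod>i=j..k. 1 - \<alpha> i)) + \<tau> k)" .
    have "(\<Prod>i=1..Suc k. 1 - \<alpha> i) = (1 - \<alpha> (Suc k)) * (\<Prod>i=1..k. 1 - \<alpha> i)"
      by simp
    then show ?thesis unfolding * by (simp only: distrib_left mult.assoc mult.left_commute add_ac)
  qed
  finally show ?case by (simp add: E_def)
qed

text \<open>
  Minimizers may form an unbounded set, and later \<open>y\<close> varies with \<open>k\<close>; hence the error is bounded by one
  null sequence for all \<open>y\<close>, with an explicit linear dependence on \<open>y\<close>. That dependence comes from the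
  initial gap alone, whose weight \<open>\<Prod>i=1..k. 1 - \<alpha> i\<close> vanishes because, multiplied by \<open>\<tau> 0 > 0\<close>, it is
  the term \<open>j = 1\<close> of the memory sum.
\<close>

lemma averaged_subgradients_approximate:
  fixes h :: "'a::real_inner \<Rightarrow> real" and x s z :: "nat \<Rightarrow> 'a" and \<alpha> \<tau> :: "nat \<Rightarrow> real"
  assumes subgradient: "\<And>k y. h (x k) + s k \<bullet> (y - x k) \<le> h y"
    and average: "\<And>k. z (Suc k) = (1 - \<alpha> k) *\<^sub>R z k + \<alpha> k *\<^sub>R s k"
    and weights: "\<And>k. 0 \<le> \<alpha> k \<and> \<alpha> k \<le> 1"
    and bounds: "\<And>k. norm (s k) \<le> S" "\<And>k. norm (z k) \<le> S"
    and steps: "\<And>k. norm (x (Suc k) - x k) \<le> M * \<tau> k"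
    and start: "z 0 = 0"
    and positive: "\<And>k. \<tau> k > 0"
    and memory: "(\<lambda>k. \<Sum>j=1..k. \<tau> (j - 1) * (\<Prod>i=j..k. 1 - \<alpha> i)) \<longlonglongrightarrow> 0"
  obtains \<epsilon> where "\<epsilon> \<longlonglongrightarrow> 0"
    and "\<And>k y. z (Suc k) \<bullet> (y - x k) \<le> h y - h (x k) + \<epsilon> k * (1 + norm (y - x 0))"
proof
  define T where "T = (\<lambda>k. \<Sum>j=1..k. \<tau> (j - 1) * (\<Prod>i=j..k. 1 - \<alpha> i))"
  define P where "P = (\<lambda>k. \<Prod>i=1..k. 1 - \<alpha> i)"
  let ?\<epsilon> = "\<lambda>k. 2 * S * M * T k + S * P k"
  have P0: "P k \<ge> 0" for k
    unfolding P_def using weights by (intro prod_nonneg) auto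
  have T0: "T k \<ge> 0" for k
    unfolding T_def using weights positive
    by (intro sum_nonneg mult_nonneg_nonneg prod_nonneg) (auto intro: less_imp_le)
  have S0: "S \<ge> 0"
    using bounds(1)[of 0] norm_ge_zero[of "s 0"] by linarith
  have "0 \<le> M * \<tau> 0"
    using steps[of 0] norm_ge_zero[of "x (Suc 0) - x 0"] by linarith
  then have M0: "M \<ge> 0"
    using positive[of 0] by (simp add: zero_le_mult_iff)
  have "P k \<le> T k / \<tau> 0" if "k \<ge> 1" for k
  proof -
    have "\<tau> (1 - 1) * (\<Prod>i=1..k. 1 - \<alpha> i) \<le> T k"
      unfolding T_def using that weights positive
      by (intro member_le_sum mult_nonneg_nonneg prod_nonneg) (auto intro: less_imp_le)
    then show ?thesis
      using positive[of 0] by (simp add: P_def field_simps)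
  qed
  then have le: "\<forall>\<^sub>F k in sequentially. P k \<le> T k / \<tau> 0"
    by (auto simp: eventually_sequentially)
  have "(\<lambda>k. T k / \<tau> 0) \<longlonglongrightarrow> 0"
    using tendsto_divide[OF memory tendsto_const, of "\<tau> 0"] positive[of 0]
    by (simp add: T_def)
  then have "P \<longlonglongrightarrow> 0"
    using le P0 by (intro tendsto_sandwich[OF _ le tendsto_const]) auto
  then show "?\<epsilon> \<longlonglongrightarrow> 0"
    using memory unfolding T_def by (auto intro!: tendsto_eq_intros)
  fix k y
  \<comment> \<open>As \<open>z 0 = 0\<close>, the initial gap is that of a shrunken subgradient, so no value of \<open>h\<close> enters.\<close>
  have "z 1 \<bullet> (y - x 0) - (h y - h (x 0))
      = \<alpha> 0 * (s 0 \<bullet> (y - x 0)) - (h y - h (x 0))"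
    using average[of 0] start by simp
  also have "\<dots> \<le> (1 - \<alpha> 0) * - (s 0 \<bullet> (y - x 0))"
    using subgradient[of 0 y] by (simp add: algebra_simps)
  also have "\<dots> \<le> 1 * (norm (s 0) * norm (y - x 0))"
    using Cauchy_Schwarz_ineq2[of "s 0" "y - x 0"] weights[of 0]
    by (smt (verit) mult_left_le_one_le mult_nonneg_nonneg mult_nonneg_nonpos norm_ge_zero)
  also have "\<dots> \<le> S * norm (y - x 0)"
    by (simp add: bounds mult_right_mono)
  finally have "P k * (z 1 \<bullet> (y - x 0) - (h y - h (x 0))) \<le> P k * (S * norm (y - x 0))"
    by (intro mult_left_mono P0)
  moreover have "z (Suc k) \<bullet> (y - x k) - (h y - h (x k))
      \<le> 2 * S * M * T k + P k * (z 1 \<bullet> (y - x 0) - (h y - h (x 0)))"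
    unfolding T_def P_def 
    by (intro averaged_subgradient_gap[where s = s] subgradient average weights bounds steps)
  moreover have "0 \<le> 2 * S * M * T k * norm (y - x 0)" "0 \<le> S * P k"
    using S0 M0 T0 P0 by auto
  ultimately show "z (Suc k) \<bullet> (y - x k) \<le> h y - h (x k) + ?\<epsilon> k * (1 + norm (y - x 0))"
    by (simp add: algebra_simps)
qed

lemma norm_average_le:
  fixes s z :: "nat \<Rightarrow> 'a::real_normed_vector"
  assumes average: "\<And>k. z (Suc k) = (1 - \<alpha> k) *\<^sub>R z k + \<alpha> k *\<^sub>R s k"
    and weights: "\<And>k. 0 \<le> \<alpha> k \<and> \<alpha> k \<le> 1"
    and start: "z 0 = 0" and bound: "\<And>k. norm (s k) \<le> S"
  shows "norm (z k) \<le> S"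
proof (induction k)
  case 0
  then show ?case using start bound[of 0] norm_ge_zero[of "s 0"] by (simp del: norm_ge_zero)
next
  case (Suc k)
  have "norm (z (Suc k)) \<le> norm ((1 - \<alpha> k) *\<^sub>R z k) + norm (\<alpha> k *\<^sub>R s k)"
    unfolding average by (rule norm_triangle_ineq)
  also have "\<dots> = (1 - \<alpha> k) * norm (z k) + \<alpha> k * norm (s k)"
    using weights[of k] by simp
  also have "\<dots> \<le> S"
    using Suc bound[of k] weights[of k] by (intro convex_bound_le) auto
  finally show ?case .
qed

section \<open>Approximate subgradient descent\<close>

text \<open>
  Divergence of the step sizes is used only in this form: nothing bounded below can decrease by a
  fixed multiple of \<open>\<tau> k\<close> forever.
\<close>

lemma no_persistent_decrease:
  fixes a \<tau> :: "nat \<Rightarrow> real"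
  assumes divergent: "filterlim (\<lambda>K. \<Sum>k\<le>K. \<tau> k) at_top sequentially"
    and nonneg: "\<And>k. a k \<ge> 0" and "c > 0"
    and decrease: "\<And>k. k \<ge> N \<Longrightarrow> a (Suc k) \<le> a k - c * \<tau> k"
  shows False
proof -
  have bound: "c * (\<Sum>k\<le>N + n. \<tau> k) \<le> c * (\<Sum>k\<le>N. \<tau> k) + a (Suc N) - a (Suc (N + n))" for n
  proof (induction n)
    case (Suc n)
    then show ?case using decrease[of "Suc (N + n)"] by (simp add: algebra_simps)
  qed simp
  define B where "B = (c * (\<Sum>k\<le>N. \<tau> k) + a (Suc N)) / c"
  obtain K where K: "\<And>n. n \<ge> K \<Longrightarrow> B + 1 \<le> (\<Sum>k\<le>n. \<tau> k)"
    using divergent unfolding filterlim_at_top eventually_sequentially by meson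
  have "c * (B + 1) \<le> c * (\<Sum>k\<le>N + K. \<tau> k)"
    using \<open>c > 0\<close> K[of "N + K"] by simp
  also have "\<dots> \<le> c * B"
    using bound[of K] nonneg[of "Suc (N + K)"] \<open>c > 0\<close> by (simp add: B_def)
  finally show False using \<open>c > 0\<close> by (simp add: algebra_simps)
qed

lemma eventually_small_error:
  fixes \<epsilon> \<tau> :: "nat \<Rightarrow> real"
  assumes "\<epsilon> \<longlonglongrightarrow> 0" "\<tau> \<longlonglongrightarrow> 0" "c > 0"
  obtains N where "\<And>k. k \<ge> N \<Longrightarrow> 2 * (\<epsilon> k * r) + \<tau> k * q < c"
proof -
  have "(\<lambda>k. 2 * (\<epsilon> k * r) + \<tau> k * q) \<longlonglongrightarrow> 0"
    using assms by (auto intro!: tendsto_eq_intros)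
  from order_tendstoD(2)[OF this \<open>c > 0\<close>] show thesis
    using that by (auto simp: eventually_sequentially)
qed

text \<open>
  A minimizer \<open>p\<close> of \<open>f\<close> over a ball containing all
  iterates is a global one: if \<open>f y < f p\<close>, then every \<open>f (x k)\<close> exceeds \<open>f y\<close> by at least \<open>f p - f y\<close>,
  and from some step on the squared distance to \<open>y\<close> would decrease by a fixed multiple of \<open>\<tau> k\<close>.

  For convergence, compactness gives a \<open>c > 0\<close> such that iterates at distance at least \<open>e\<close> from \<open>X\<close> have
  values at least \<open>c\<close> above the minimum. Late iterates outside the \<open>e\<close>-neighbourhood of \<open>X\<close> come
  closer to \<open>X\<close> with each step and must enter it at some time; a single step is shorter than \<open>e\<close>, so from then on they stay
  within \<open>2 * e\<close>.
\<close>

lemma approximate_subgradient_descent: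
  fixes f :: "'a::euclidean_space \<Rightarrow> real" and x g :: "nat \<Rightarrow> 'a" and \<tau> \<epsilon> :: "nat \<Rightarrow> real"
  assumes f: "continuous_on UNIV f"
    and step: "\<And>k. x (Suc k) = x k - \<tau> k *\<^sub>R g k"
    and approx: "\<And>k y. g k \<bullet> (y - x k) \<le> f y - f (x k) + \<epsilon> k * (1 + norm (y - x 0))"
    and errors: "\<epsilon> \<longlonglongrightarrow> 0"
    and g: "\<And>k. norm (g k) \<le> M"
    and x: "\<And>k. norm (x k) \<le> R"
    and positive: "\<And>k. \<tau> k > 0" and null: "\<tau> \<longlonglongrightarrow> 0"
    and divergent: "filterlim (\<lambda>K. \<Sum>k\<le>K. \<tau> k) at_top sequentially"
  defines "X \<equiv> {p. \<forall>y. f p \<le> f y}"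
  shows "X \<noteq> {}" and "(\<lambda>k. infdist (x k) X) \<longlonglongrightarrow> 0"
proof -
  have M0: "M \<ge> 0" and R0: "R \<ge> 0"
    using g[of 0] x[of 0] norm_ge_zero[of "g 0"] norm_ge_zero[of "x 0"] by linarith+
  have descent: "(norm (x (Suc k) - y))\<^sup>2 \<le> (norm (x k - y))\<^sup>2
      - \<tau> k * (2 * (f (x k) - f y) - (2 * (\<epsilon> k * (1 + norm (y - x 0))) + \<tau> k * M\<^sup>2))" for k y
  proof -
    have "(norm (x (Suc k) - y))\<^sup>2
        = (norm (x k - y))\<^sup>2 + 2 * \<tau> k * (g k \<bullet> (y - x k)) + \<tau> k * (\<tau> k * (norm (g k))\<^sup>2)"
      unfolding step power2_norm_eq_inner
      by (simp add: inner_diff_left inner_diff_right inner_commute algebra_simps)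
    moreover have "2 * \<tau> k * (g k \<bullet> (y - x k))
        \<le> 2 * \<tau> k * (f y - f (x k) + \<epsilon> k * (1 + norm (y - x 0)))"
      using positive[of k] approx[of k y] by (intro mult_left_mono) auto
    moreover have "\<tau> k * (\<tau> k * (norm (g k))\<^sup>2) \<le> \<tau> k * (\<tau> k * M\<^sup>2)"
      using positive[of k] g[of k] by (intro mult_left_mono power_mono) auto
    ultimately show ?thesis by (simp add: algebra_simps)
  qed
  have "continuous_on (cball 0 R) f"
    using f continuous_on_subset by blast
  then obtain p where p: "\<And>y. norm y \<le> R \<Longrightarrow> f p \<le> f y" and pR: "norm p \<le> R"
    using continuous_attains_inf[of "cball 0 R" f] R0
    by (metis cball_eq_empty compact_cball mem_cball_0 not_less)
  have pX: "p \<in> X"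
  proof (rule ccontr)
    assume "p \<notin> X"
    then obtain y where y: "f y < f p" by (auto simp: X_def not_le)
    then obtain N where N: "\<And>k. k \<ge> N \<Longrightarrow>
        2 * (\<epsilon> k * (1 + norm (y - x 0))) + \<tau> k * M\<^sup>2 < f p - f y"
      using eventually_small_error[OF errors null, of "f p - f y" "1 + norm (y - x 0)" "M\<^sup>2"]
      by auto
    have "(norm (x (Suc k) - y))\<^sup>2 \<le> (norm (x k - y))\<^sup>2 - (f p - f y) * \<tau> k" if "k \<ge> N" for k
    proof -
      have "\<tau> k * (f p - f y)
          \<le> \<tau> k * (2 * (f (x k) - f y) - (2 * (\<epsilon> k * (1 + norm (y - x 0))) + \<tau> k * M\<^sup>2))"
        using positive[of k] N[OF that] p[OF x, of k] by (intro mult_left_mono) auto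
      then show ?thesis using descent[of k y] by (simp add: mult.commute)
    qed
    then show False
      using y by (intro no_persistent_decrease[OF divergent,
            of "\<lambda>k. (norm (x k - y))\<^sup>2" "f p - f y" N]) auto
  qed
  then show X: "X \<noteq> {}" by auto
  have X_eq: "X = {q. f q \<le> f p}"
    using pX by (auto simp: X_def intro: order_trans)
  have "closed X"
    unfolding X_eq using f by (intro closed_Collect_le continuous_on_const)
  define d where "d = (\<lambda>k. infdist (x k) X)"
  have Lipschitz: "d (Suc k) \<le> d k + M * \<tau> k" for k
  proof -
    have "d (Suc k) \<le> d k + dist (x (Suc k)) (x k)"
      unfolding d_def by (rule infdist_triangle)
    also have "dist (x (Suc k)) (x k) = norm (g k) * \<tau> k"
      using positive[of k] by (simp add: step dist_norm)
    also have "\<dots> \<le> M * \<tau> k"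
      using positive[of k] g by (intro mult_right_mono) auto
    finally show ?thesis by simp
  qed
  have small: "\<forall>\<^sub>F k in sequentially. d k < 2 * e" if "e > 0" for e
  proof -
    define C where "C = cball 0 R \<inter> {q. e \<le> infdist q X}"
    have "compact C"
      unfolding C_def
      by (intro compact_Int_closed compact_cball closed_Collect_le continuous_intros)
    obtain c where "c > 0" and c: "\<And>q. q \<in> C \<Longrightarrow> c \<le> f q - f p"
    proof (cases "C = {}")
      case True
      with that[of 1] show thesis by simp
    next
      case False
      then obtain q where q: "q \<in> C" "\<And>y. y \<in> C \<Longrightarrow> f q \<le> f y"
        using continuous_attains_inf[OF \<open>compact C\<close>, of f] f continuous_on_subset by blast
      then have "q \<notin> X" using \<open>e > 0\<close> by (auto simp: C_def)
      then have "f q > f p" by (simp add: X_eq)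
      with that[of "f q - f p"] q show thesis by force
    qed
    obtain N1 where N1: "\<And>k. k \<ge> N1 \<Longrightarrow> 2 * (\<bar>\<epsilon> k\<bar> * (1 + 4 * R)) + \<tau> k * M\<^sup>2 < c"
      using eventually_small_error[OF tendsto_rabs_zero[OF errors] null \<open>c > 0\<close>] by blast
    have "(\<lambda>k. M * \<tau> k) \<longlonglongrightarrow> 0"
      using null by (auto intro!: tendsto_eq_intros)
    from order_tendstoD(2)[OF this \<open>e > 0\<close>] obtain N2 where N2: "\<And>k. k \<ge> N2 \<Longrightarrow> M * \<tau> k < e"
      by (auto simp: eventually_sequentially)
    define N where "N = max N1 N2"
    have far: "(d (Suc k))\<^sup>2 \<le> (d k)\<^sup>2 - c * \<tau> k" if "k \<ge> N" "e \<le> d k" for k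
    proof -
      obtain y where y: "y \<in> X" "d k = dist (x k) y"
        unfolding d_def using infdist_attains_inf[OF \<open>closed X\<close> X] by metis
      \<comment> \<open>The nearest minimizer lies in a fixed ball: it is at most as far from \<open>x k\<close> as \<open>p\<close> is, hence
          at distance at most \<open>2 * R\<close> from \<open>x k\<close> and \<open>4 * R\<close> from \<open>x 0\<close>.\<close>
      have "dist (x k) y \<le> dist (x k) p"
        using y(2) infdist_le[OF pX, of "x k"] by (simp add: d_def)
      then have "norm (y - x 0) \<le> 4 * R"
        using pR x[of k] x[of 0] norm_triangle_ineq4[of "x k" p] norm_triangle_ineq4[of y "x k"]
          norm_triangle_ineq4[of "x k" "x 0"] norm_triangle_ineq[of "y - x k" "x k - x 0"]
        by (simp add: dist_norm norm_minus_commute)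
      then have "\<epsilon> k * (1 + norm (y - x 0)) \<le> \<bar>\<epsilon> k\<bar> * (1 + 4 * R)"
        by (intro mult_mono) auto
      moreover have "f y = f p" using y(1) pX by (auto simp: X_def intro: antisym)
      moreover have "x k \<in> C" using that x by (simp add: C_def d_def)
      ultimately have "c \<le> 2 * (f (x k) - f y) - (2 * (\<epsilon> k * (1 + norm (y - x 0))) + \<tau> k * M\<^sup>2)"
        using c[of "x k"] N1[of k] that by (simp add: N_def)
      then have "\<tau> k * c
          \<le> \<tau> k * (2 * (f (x k) - f y) - (2 * (\<epsilon> k * (1 + norm (y - x 0))) + \<tau> k * M\<^sup>2))"
        using positive[of k] by (intro mult_left_mono) auto
      moreover have "(d (Suc k))\<^sup>2 \<le> (norm (x (Suc k) - y))\<^sup>2"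
        using infdist_le[OF y(1), of "x (Suc k)"]
        by (intro power_mono) (auto simp: d_def dist_norm infdist_nonneg)
      ultimately show ?thesis
        using descent[of k y] by (simp add: y(2) dist_norm mult.commute)
    qed
    have "\<exists>k\<ge>N. d k < e"
    proof (rule ccontr)
      assume "\<not> (\<exists>k\<ge>N. d k < e)"
      then have "\<And>k. k \<ge> N \<Longrightarrow> (d (Suc k))\<^sup>2 \<le> (d k)\<^sup>2 - c * \<tau> k"
        by (intro far) (auto simp: not_less)
      then show False
        by (intro no_persistent_decrease[OF divergent, of "\<lambda>k. (d k)\<^sup>2" c N] \<open>c > 0\<close>) auto
    qed
    then obtain K where K: "K \<ge> N" "d K < e" by auto
    have "d k < 2 * e" if "k \<ge> K" for k
      using that
    proof (induction k rule: dec_induct)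
      case base
      then show ?case using K \<open>e > 0\<close> by simp
    next
      case (step k)
      show ?case
      proof (cases "d k < e")
        case True
        then show ?thesis using Lipschitz[of k] N2[of k] step K by (simp add: N_def)
      next
        case False
        then have "(d (Suc k))\<^sup>2 \<le> (d k)\<^sup>2 - c * \<tau> k"
          using far[of k] step K by simp
        also have "\<dots> \<le> (d k)\<^sup>2" using \<open>c > 0\<close> positive[of k] by simp
        finally have "d (Suc k) \<le> d k"
          by (rule power2_le_imp_le) (simp add: d_def infdist_nonneg)
        then show ?thesis using step by simp
      qed
    qed
    then show ?thesis by (auto simp: eventually_sequentially)
  qed
  show "(\<lambda>k. infdist (x k) X) \<longlonglongrightarrow> 0"
  proof (rule tendstoI)
    fix e :: real assume "e > 0"
    then show "\<forall>\<^sub>F k in sequentially. dist (infdist (x k) X) 0 < e"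
      using small[of "e / 2"] by (simp add: d_def infdist_nonneg)
  qed
qed

section \<open>The two parts of the objective\<close>

lemma transpose_rows_mult_vec_map:
  "transpose_rows_mult_vec R (map \<phi> (rows_mult_vec R x)) = (\<Sum>r\<leftarrow>R. \<phi> (r \<bullet> x) *\<^sub>R r)"
  by (simp add: transpose_rows_mult_vec_def rows_mult_vec_def sum_list_sum_nth atLeast0LessThan)

lemma sum_list_concat_map:
  fixes f :: "'a \<Rightarrow> 'b::comm_monoid_add"
  shows "(\<Sum>r\<leftarrow>concat Rs. f r) = (\<Sum>R\<leftarrow>Rs. \<Sum>r\<leftarrow>R. f r)"
  by (induction Rs) auto

lemma l1_norm_subgradient:
  fixes R :: "'n::finite rows"
  shows "l1_norm (rows_mult_vec R x) + (\<Sum>r\<leftarrow>R. sgn (r \<bullet> x) *\<^sub>R r) \<bullet> (y - x)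
    \<le> l1_norm (rows_mult_vec R y)"
proof (induction R)
  case Nil
  then show ?case by (simp add: l1_norm_def rows_mult_vec_def)
next
  case (Cons r R)
  have "\<bar>r \<bullet> x\<bar> + sgn (r \<bullet> x) * (r \<bullet> (y - x)) = sgn (r \<bullet> x) * (r \<bullet> y)"
    by (simp add: inner_diff_right algebra_simps abs_sgn)
  also have "\<dots> \<le> \<bar>r \<bullet> y\<bar>"
    by (auto simp: sgn_real_def abs_if)
  finally show ?case
    using Cons by (simp add: l1_norm_def rows_mult_vec_def inner_add_left)
qed

lemma norm_l1_subgradient_le:
  fixes R :: "'n::finite rows"
  shows "norm (\<Sum>r\<leftarrow>R. sgn (r \<bullet> x) *\<^sub>R r) \<le> (\<Sum>r\<leftarrow>R. norm r)"
proof (induction R)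
  case (Cons r R)
  have "norm (sgn (r \<bullet> x) *\<^sub>R r) \<le> norm r"
    by (simp add: sgn_real_def)
  then show ?case
    using Cons norm_triangle_ineq[of "sgn (r \<bullet> x) *\<^sub>R r" "\<Sum>r\<leftarrow>R. sgn (r \<bullet> x) *\<^sub>R r"] by simp
qed simp

lemma diagonal_inner:
  fixes W :: "real ^ 'm ^ 'm"
  assumes "\<And>i j. i \<noteq> j \<Longrightarrow> W $ i $ j = 0"
  shows "u \<bullet> (W *v v) = (\<Sum>i\<in>UNIV. W $ i $ i * u $ i * v $ i)"
proof -
  have "(W *v v) $ i = W $ i $ i * v $ i" for i
  proof -
    have "(\<Sum>j\<in>UNIV. W $ i $ j * v $ j) = (\<Sum>j\<in>UNIV. if j = i then W $ i $ i * v $ i else 0)"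
      by (rule sum.cong) (auto simp: assms)
    then show ?thesis by (simp add: matrix_vector_mult_def)
  qed
  then show ?thesis by (simp add: inner_vec_def algebra_simps)
qed

text \<open>
  A quadratic with positive semidefinite Hessian lies above its tangents: with \<open>v = A *v (y - x)\<close>, the
  difference of the two sides is \<open>v \<bullet> (W *v v) / 2\<close>.
\<close>

lemma weighted_least_squares_subgradient:
  fixes A :: "real ^ 'n ^ 'm" and W :: "real ^ 'm ^ 'm"
  assumes diagonal: "\<And>i j. i \<noteq> j \<Longrightarrow> W $ i $ j = 0" and nonneg: "\<And>i. W $ i $ i \<ge> 0"
  shows "1 / 2 * (weighted_norm W (A *v x - b))\<^sup>2 + (transpose A *v (W *v (A *v x - b))) \<bullet> (y - x)
    \<le> 1 / 2 * (weighted_norm W (A *v y - b))\<^sup>2"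
proof -
  have diag: "u \<bullet> (W *v v) = (\<Sum>i\<in>UNIV. W $ i $ i * u $ i * v $ i)" for u v
    by (rule diagonal_inner) (rule diagonal)
  \<comment> \<open>This also makes the square in \<open>weighted_norm\<close> cancel the root, which is odd for negative arguments.\<close>
  have psd: "u \<bullet> (W *v u) \<ge> 0" for u
    unfolding diag using nonneg by (intro sum_nonneg) (simp add: mult.assoc)
  have sym: "u \<bullet> (W *v v) = v \<bullet> (W *v u)" for u v
    unfolding diag by (simp add: mult_ac)
  define u where "u = A *v x - b"
  define v where "v = A *v (y - x)"
  have y: "A *v y - b = u + v"
    by (simp add: u_def v_def matrix_vector_mult_diff_distrib)
  have "(transpose A *v (W *v u)) \<bullet> (y - x) = v \<bullet> (W *v u)"
    by (metis dot_lmul_matrix inner_commute transpose_matrix_vector v_def)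
  then show ?thesis
    using psd[of v] psd[of u] psd[of "u + v"] sym[of u v]
    unfolding u_def[symmetric] y weighted_norm_def
    by (simp add: inner_add_left inner_add_right matrix_vector_right_distrib)
qed

theorem theorem1:
  fixes A :: "real ^ 'n ^ 'm" and b :: "real ^ 'm" and W :: "real ^ 'm ^ 'm"
    and lam :: real
    and D :: "'n rows" and Ds :: "'n rows list"
    and \<tau> \<sigma> \<alpha> :: "nat \<Rightarrow> real"
    and x xbar z :: "nat \<Rightarrow> real ^ 'n" and t :: "nat \<Rightarrow> real ^ 'm"
  assumes "CARD('m) \<le> CARD('n)"
    and "\<And>i j. i \<noteq> j \<Longrightarrow> W $ i $ j = 0" and "\<And>i. W $ i $ i > 0"
    and "lam > 0"
    and "D = concat Ds" and "length D > CARD('n)"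
    and "\<And>k. 0 \<le> \<alpha> k \<and> \<alpha> k \<le> 1" and "\<And>k. \<sigma> k > 0" and "\<And>k. \<tau> k > 0"
    and "pdfw_iterates A b W lam Ds \<tau> \<sigma> \<alpha> 0 x xbar z t"
    and "bounded (x ` {1..})"
    and "\<tau> \<longlonglongrightarrow> 0"
    and "filterlim (\<lambda>K. \<Sum>k\<le>K. \<tau> k) at_top sequentially"
    and "(\<lambda>k. \<Sum>j=1..k. \<tau> (j - 1) * (\<Prod>i=j..k. 1 - \<alpha> i)) \<longlonglongrightarrow> 0"
    and "(\<lambda>k. \<Sum>j=1..k. \<tau> (j - 1) * (\<Prod>i=j..k. 1 / (1 + \<sigma> i))) \<longlonglongrightarrow> 0"
  shows "minimizers A b W lam D \<noteq> {}
     \<and> (\<lambda>k. infdist (x k) (minimizers A b W lam D)) \<longlonglongrightarrow> 0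
     \<and> (\<forall>xs. minimizers A b W lam D = {xs} \<longrightarrow> x \<longlonglongrightarrow> xs)"
proof -
  define h where "h = (\<lambda>y. lam * l1_norm (rows_mult_vec D y))"
  define q where "q = (\<lambda>y. 1 / 2 * (weighted_norm W (A *v y - b))\<^sup>2)"
  define hs where "hs = (\<lambda>k. lam *\<^sub>R (\<Sum>r\<leftarrow>D. sgn (r \<bullet> x k) *\<^sub>R r))"
  define qs where "qs = (\<lambda>k. transpose A *v (W *v (A *v x k - b)))"
  define w where "w = (\<lambda>k. transpose A *v t k)"
  define \<beta> where "\<beta> = (\<lambda>k. \<sigma> k / (1 + \<sigma> k))"
  note iter = assms(10)[unfolded pdfw_iterates_def]
  have xbar: "xbar k = x k" for k
    using iter by (cases k) auto
  have \<beta>: "1 - \<beta> k = 1 / (1 + \<sigma> k)" "0 \<le> \<beta> k \<and> \<beta> k \<le> 1" for k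
    using assms(8)[of k] by (auto simp: \<beta>_def field_simps)
  \<comment> \<open>Both directions are running averages; for \<open>w\<close> the weights are \<open>\<beta>\<close>, and the factors
      \<open>1 / (1 + \<sigma> i)\<close> of the second memory sum are \<open>1 - \<beta> i\<close>.\<close>
  have z_rec: "z (Suc k) = (1 - \<alpha> k) *\<^sub>R z k + \<alpha> k *\<^sub>R hs k" for k
    using iter by (simp add: xbar transpose_rows_mult_vec_map sum_list_concat_map hs_def assms(5))
  have w_rec: "w (Suc k) = (1 - \<beta> k) *\<^sub>R w k + \<beta> k *\<^sub>R qs k" for k
    using iter unfolding \<beta>(1)
    by (simp add: xbar w_def qs_def \<beta>_def matrix_vector_right_distrib matrix_vector_mult_scaleR
        del: transpose_matrix_vector)
  have z0: "z 0 = 0" and w0: "w 0 = 0"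
    using iter by (auto simp: w_def)
  have step: "x (Suc k) = x k - \<tau> k *\<^sub>R (w (Suc k) + z (Suc k))" for k
    using iter by (simp add: w_def)
  have hs: "h (x k) + hs k \<bullet> (y - x k) \<le> h y" for k y
    using mult_left_mono[OF l1_norm_subgradient[of D "x k" y], of lam] assms(4)
    by (simp add: h_def hs_def algebra_simps)
  have qs: "q (x k) + qs k \<bullet> (y - x k) \<le> q y" for k y
    unfolding q_def qs_def
    by (rule weighted_least_squares_subgradient) (use assms(2,3) less_imp_le in blast)+

  \<comment> \<open>Bounded iterates have bounded subgradients, so the averages and the directions are bounded.\<close>
  have "(UNIV :: nat set) = insert 0 {1..}" by auto
  then have "range x = insert (x 0) (x ` {1..})" by (metis image_insert)
  with assms(11) have bdd: "bounded (range x)" by simp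
  then obtain R where R: "\<And>k. norm (x k) \<le> R"
    by (auto simp: bounded_iff)
  have hs_bound: "norm (hs k) \<le> lam * (\<Sum>r\<leftarrow>D. norm r)" for k
    using norm_l1_subgradient_le[where R = D and x = "x k"] assms(4)
    by (simp add: hs_def mult_left_mono)
  have "bounded ((\<lambda>y. transpose A *v (W *v (A *v y))) ` range x)"
    using bounded_linear_compose[OF matrix_vector_mul_bounded_linear
        bounded_linear_compose[OF matrix_vector_mul_bounded_linear matrix_vector_mul_bounded_linear]]
    by (intro bounded_linear_image bdd)
  then obtain Q where Q: "\<And>k. norm (transpose A *v (W *v (A *v x k))) \<le> Q"
    by (auto simp: bounded_iff)
  have qs_bound: "norm (qs k) \<le> Q + norm (transpose A *v (W *v b))" for k
    using Q[of k] norm_triangle_ineq4[of "transpose A *v (W *v (A *v x k))" "transpose A *v (W *v b)"]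
    by (simp add: qs_def matrix_vector_mult_diff_distrib)
  note z_bound = norm_average_le[OF z_rec assms(7) z0 hs_bound]
  note w_bound = norm_average_le[OF w_rec \<beta>(2) w0 qs_bound]
  obtain M where g: "\<And>k. norm (w (Suc k) + z (Suc k)) \<le> M"
    using norm_triangle_mono[OF w_bound z_bound] by blast
  have steps: "norm (x (Suc k) - x k) \<le> M * \<tau> k" for k
    using mult_right_mono[OF g, of "\<tau> k" k] assms(9)[of k] by (simp add: step mult.commute)

  obtain \<epsilon> where \<epsilon>: "\<epsilon> \<longlonglongrightarrow> 0"
    "\<And>k y. z (Suc k) \<bullet> (y - x k) \<le> h y - h (x k) + \<epsilon> k * (1 + norm (y - x 0))"
    using averaged_subgradients_approximate[where h = h and x = x and z = z and \<tau> = \<tau>,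
        OF hs z_rec assms(7) hs_bound z_bound steps z0
        assms(9) assms(14)] by blast
  obtain \<delta> where \<delta>: "\<delta> \<longlonglongrightarrow> 0"
    "\<And>k y. w (Suc k) \<bullet> (y - x k) \<le> q y - q (x k) + \<delta> k * (1 + norm (y - x 0))"
    using averaged_subgradients_approximate[where h = q and x = x and z = w and \<tau> = \<tau>,
        OF qs w_rec \<beta>(2) qs_bound w_bound steps w0
        assms(9)] assms(15) unfolding \<beta>(1) by blast

  define f where "f = objective A b W lam D"
  have f_eq: "f y = q y + h y" for y
    by (simp add: f_def objective_def q_def h_def)
  have approx: "(w (Suc k) + z (Suc k)) \<bullet> (y - x k)
      \<le> f y - f (x k) + (\<epsilon> k + \<delta> k) * (1 + norm (y - x 0))" for k y
    using \<epsilon>(2)[of k y] \<delta>(2)[of k y] by (simp add: f_eq inner_add_left algebra_simps)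
  have f: "continuous_on UNIV f"
  proof -
    have "continuous_on UNIV (\<lambda>y. \<Sum>r\<leftarrow>D. \<bar>r \<bullet> y\<bar>)"
      unfolding sum_list_sum_nth by (auto intro!: continuous_intros)
    then have "continuous_on UNIV h"
      by (auto simp: h_def l1_norm_def rows_mult_vec_def o_def intro!: continuous_intros)
    moreover have "continuous_on UNIV q"
      unfolding q_def weighted_norm_def
      by (intro continuous_intros linear_continuous_on_compose[OF _ matrix_vector_mul_linear])
    ultimately show ?thesis
      unfolding f_eq[abs_def] by (intro continuous_intros)
  qed
  have errors: "(\<lambda>k. \<epsilon> k + \<delta> k) \<longlonglongrightarrow> 0"
    using tendsto_add[OF \<epsilon>(1) \<delta>(1)] by simp
  have X: "minimizers A b W lam D = {p. \<forall>y. f p \<le> f y}"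
    by (auto simp: minimizers_def f_def is_arg_min_def not_less)
  note conv = approximate_subgradient_descent[OF f step approx errors g R assms(9,12,13), folded X]
  show ?thesis
  proof (intro conjI allI impI)
    fix xs assume "minimizers A b W lam D = {xs}"
    then have "(\<lambda>k. dist (x k) xs) \<longlonglongrightarrow> 0"
      using conv(2) by simp
    then show "x \<longlonglongrightarrow> xs"
      by (rule tendsto_dist_iff[THEN iffD2])
  qed (use conv in auto)
qed

end
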